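(* Let $\varphi_S(z)=1+\sin z$ and $\varphi_{SG}(z)=\dfrac{2}{1+e^{-z}}$ for $z\in\mathbb D$. Then the sharp $\mathcal S^*(\varphi_{SG})$-radius of $\mathcal S^*(\varphi_S)$ is $$R_{\mathcal S^*(\varphi_{SG})}(\mathcal S^*(\varphi_S))=\arcsin\frac{e-1}{e+1}.$$
   Context: Let $\mathbb D=\{z\in\mathbb C:|z|<1\}$ and let $\mathcal A$ be the class of functions $f$ analytic on $\mathbb D$ with $f(0)=0$ and $f'(0)=1$. For an analytic function $\varphi$ on $\mathbb D$ with $\varphi(0)=1$, the class $\mathcal S^*(\varphi)$ consists of all $f\in\mathcal A$ with $zf'(z)/f(z)\prec\varphi(z)$; that is, there is an analytic $\omega:\mathbb D\to\mathbb D$ with $\omega(0)=0$ such that $zf'(z)/f(z)=\varphi(\omega(z))$ on $\mathbb D$ (the quotient takes the value $1$ at $z=0$, and $f$ has no other zeros). For two such functions $\varphi_1,\varphi_2$, the sharp $\mathcal S^*(\varphi_2)$-radius of $\mathcal S^*(\varphi_1)$ is $$R_{\mathcal S^*(\varphi_2)}(\mathcal S^*(\varphi_1))=\sup\left\{r\in(0,1]: f_r(z)=\tfrac{f(rz)}{r}\text{ belongs to }\mathcal S^*(\varphi_2)\text{ for every } f\in\mathcal S^*(\varphi_1)\right\}.$$ *)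

theory Defs
  imports "HOL-Complex_Analysis.Complex_Analysis"
begin

abbreviation unit_disc :: "complex set" where
  "unit_disc \<equiv> ball 0 1"

definition class_A :: "(complex \<Rightarrow> complex) set" where
  "class_A = {f. f holomorphic_on unit_disc \<and> f 0 = 0 \<and> deriv f 0 = 1}"

definition subordinate :: "(complex \<Rightarrow> complex) \<Rightarrow> (complex \<Rightarrow> complex) \<Rightarrow> bool" where
  "subordinate g \<phi> \<longleftrightarrow>
     (\<exists>\<omega>. \<omega> holomorphic_on unit_disc \<and> \<omega> ` unit_disc \<subseteq> unit_disc \<and> \<omega> 0 = 0 \<and>
          (\<forall>z\<in>unit_disc. g z = \<phi> (\<omega> z)))"

(* The value 1 at the origin is the limit of z f'(z) / f(z) for f in class_A;
   without the case split, HOL's division by zero would yield 0 there. *)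
definition starlike_quotient :: "(complex \<Rightarrow> complex) \<Rightarrow> complex \<Rightarrow> complex" where
  "starlike_quotient f z = (if z = 0 then 1 else z * deriv f z / f z)"

(* The absence of further zeros is required explicitly because the quotient is total in HOL. *)
definition starlike_class :: "(complex \<Rightarrow> complex) \<Rightarrow> (complex \<Rightarrow> complex) set" where
  "starlike_class \<phi> =
     {f \<in> class_A. (\<forall>z\<in>unit_disc - {0}. f z \<noteq> 0) \<and> subordinate (starlike_quotient f) \<phi>}"

(* starlike_radius \<phi>2 \<phi>1 is the S*(\<phi>2)-radius of S*(\<phi>1). *)
definition starlike_radius :: "(complex \<Rightarrow> complex) \<Rightarrow> (complex \<Rightarrow> complex) \<Rightarrow> real" where
  "starlike_radius \<phi>2 \<phi>1 =
     Sup {r. 0 < r \<and> r \<le> 1 \<and>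
             (\<forall>f\<in>starlike_class \<phi>1.
                (\<lambda>z. f (of_real r * z) / of_real r) \<in> starlike_class \<phi>2)}"

definition phi_S :: "complex \<Rightarrow> complex" where
  "phi_S z = 1 + sin z"

definition phi_SG :: "complex \<Rightarrow> complex" where
  "phi_SG z = 2 / (1 + exp (- z))"

end

theory Submission
  imports Defs
begin

text \<open>
  The map \<open>\<phi>\<^sub>S\<^sub>G\<close> is \<open>1 + tanh (z/2)\<close>, so \<open>\<phi>\<^sub>S = \<phi>\<^sub>S\<^sub>G \<circ> \<psi>\<close> near the origin, where
  \<open>\<psi> = 2 artanh \<circ> sin\<close> is the primitive of \<open>2 / cos\<close> vanishing at \<open>0\<close>. Since
  \<open>\<bar>cos z\<bar> \<ge> cos \<bar>z\<bar>\<close>, we get \<open>\<bar>\<psi> z\<bar> \<le> \<psi> \<bar>z\<bar>\<close>, and \<open>\<psi> \<rho> = 1\<close> exactly for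
  \<open>\<rho> = arcsin ((e - 1) / (e + 1))\<close>. By the Schwarz lemma, \<open>\<psi> (\<omega> (\<rho> z))\<close> is therefore a
  Schwarz function whenever \<open>\<omega>\<close> is one. Conversely, for the function with
  \<open>z f'(z) / f(z) = 1 + sin z\<close>, every preimage of \<open>1 + sin \<rho>\<close> under \<open>\<phi>\<^sub>S\<^sub>G\<close> lies in
  \<open>1 + 2 \<pi> i \<int>\<close>, hence outside the disc.
\<close>

text \<open>Since \<open>|cos z|^2 = cos (Re z)^2 + sinh (Im z)^2\<close>, the modulus is at least
  \<open>|cos (Re z)|\<close>. The rest is \<open>|Re z| \<le> |z|\<close> and the decrease of
  cosine on \<open>[0, pi]\<close>, whence the bound \<open>pi\<close>.\<close>

lemma cos_norm_le_norm_cos: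
  fixes z :: complex
  assumes "norm z \<le> pi"
  shows "cos (norm z) \<le> norm (cos z)"
proof -
  have "cos (norm z) \<le> cos \<bar>Re z\<bar>"
    using assms abs_Re_le_cmod[of z] by (intro cos_monotone_0_pi_le) auto
  also have "\<dots> \<le> \<bar>cos (Re z)\<bar>"
    by simp
  also have "\<dots> \<le> norm (cos z)"
    by (rule abs_le_square_iff[THEN iffD2, of _ "norm (cos z)", simplified])
       (simp add: norm_cos_squared)
  finally show ?thesis .
qed

text \<open>Taking \<open>\<psi>\<close> as a primitive of \<open>2 / cos\<close>, which is
  holomorphic on the disc of radius \<open>pi/2\<close>, avoids choosing a branch of the logarithm.
  Integrating the bound on the derivative along a radius gives the majorant, which is the real
  primitive of \<open>2 / cos\<close> evaluated at \<open>norm z\<close>.\<close>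

lemma artanh_sin_majorised:
  obtains \<psi> :: "complex \<Rightarrow> complex"
  where "\<psi> holomorphic_on ball 0 (pi/2)" "\<psi> 0 = 0"
    and "\<And>z. norm z < pi/2 \<Longrightarrow> (1 - sin z) * exp (\<psi> z) = 1 + sin z"
    and "\<And>z. norm z < pi/2 \<Longrightarrow> norm (\<psi> z) \<le> ln ((1 + sin (norm z)) / (1 - sin (norm z)))"
proof -
  define B :: "complex set" where "B = ball 0 (pi/2)"
  have B: "convex B" "open B" "0 \<in> B"
    by (auto simp: B_def)
  have cos_pos: "cos (norm z) > 0" if "z \<in> B" for z
    using that by (intro cos_gt_zero_pi) (auto simp: B_def intro: less_le_trans[OF _ norm_ge_zero])
  have cos_le: "cos (norm z) \<le> norm (cos z)" if "z \<in> B" for z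
  proof (rule cos_norm_le_norm_cos)
    have "norm z < pi/2"
      using that by (simp add: B_def)
    then show "norm z \<le> pi"
      using pi_gt_zero by linarith
  qed
  have cos_nz: "cos z \<noteq> 0" if "z \<in> B" for z
    using cos_pos[OF that] cos_le[OF that] by auto
  have "(\<lambda>z. 2 / cos z) holomorphic_on B"
    by (intro holomorphic_intros) (use cos_nz in auto)
  then obtain G where G: "\<And>z. z \<in> B \<Longrightarrow> (G has_field_derivative 2 / cos z) (at z within B)"
    using holomorphic_convex_primitive'[OF B(1,2)] by blast
  define \<psi> where "\<psi> z = G z - G 0" for z
  have d\<psi>: "(\<psi> has_field_derivative 2 / cos z) (at z)" if "z \<in> B" for z
    using DERIV_diff[OF G[OF that] DERIV_const[of "G 0"]]
    by (simp add: \<psi>_def[abs_def] at_within_open[OF that B(2)])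
  have "\<psi> holomorphic_on B"
    using d\<psi> B(2) by (auto simp: holomorphic_on_open)
  moreover have "\<psi> 0 = 0"
    by (simp add: \<psi>_def)
  moreover have "(1 - sin z) * exp (\<psi> z) = 1 + sin z" if z: "z \<in> B" for z
  proof -
    have nz: "1 + sin w \<noteq> 0" if "w \<in> B" for w
    proof
      assume "1 + sin w = 0"
      moreover have "(cos w)\<^sup>2 = (1 + sin w) * (1 - sin w)"
        by (simp add: cos_squared_eq power2_eq_square algebra_simps)
      ultimately show False
        using cos_nz[OF that] by simp
    qed
    \<comment> \<open>The claim says that this quotient of its two sides is 1. It is shown to be
      constant and then evaluated at 0.\<close>
    define h where "h w = (1 - sin w) * exp (\<psi> w) / (1 + sin w)" for w
    have "(h has_field_derivative 0) (at w within B)" if w: "w \<in> B" for w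
    proof -
      have "(h has_field_derivative
              ((- cos w * exp (\<psi> w) + (1 - sin w) * (exp (\<psi> w) * (2 / cos w))) * (1 + sin w)
                - (1 - sin w) * exp (\<psi> w) * cos w) / ((1 + sin w) * (1 + sin w))) (at w)"
        unfolding h_def
        by (rule derivative_eq_intros d\<psi>[OF w] refl nz[OF w] | simp add: algebra_simps)+
      \<comment> \<open>With \<open>x = sin w\<close> and \<open>c = cos w\<close>, the numerator of
        the quotient rule acquires the factor \<open>1 - sin^2 - cos^2\<close>, which
        vanishes.\<close>
      moreover have "(- c * E + (1 - x) * (E * (2 / c))) * (1 + x) - (1 - x) * E * c =
          2 * E / c * ((1 - x) * (1 + x) - c\<^sup>2)" if "c \<noteq> 0" for c x E :: complex
        using that by (simp add: field_simps power2_eq_square)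
      note this[OF cos_nz[OF w]]
      moreover have "(1 - sin w) * (1 + sin w) - (cos w)\<^sup>2 = 0"
        by (simp add: cos_squared_eq power2_eq_square algebra_simps)
      ultimately show ?thesis
        by (simp add: has_field_derivative_at_within)
    qed
    then obtain c where c: "\<And>w. w \<in> B \<Longrightarrow> h w = c"
      using has_field_derivative_zero_constant[OF B(1)] by metis
    have "h z = h 0"
      using c[OF z] c[OF B(3)] by simp
    also have "h 0 = 1"
      by (simp add: h_def \<open>\<psi> 0 = 0\<close>)
    finally show ?thesis
      using nz[OF z] by (simp add: h_def field_simps)
  qed
  moreover have "norm (\<psi> z) \<le> ln ((1 + sin (norm z)) / (1 - sin (norm z)))" if z: "z \<in> B" for z
  proof (cases "z = 0")
    case False
    define u where "u = z / of_real (norm z)"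
    have u: "norm u = 1" "z = of_real (norm z) * u"
      using False by (auto simp: u_def norm_divide)
    \<comment> \<open>The majorant as a function on the radius through \<open>z\<close>; its
      derivative \<open>2 / cos t\<close> dominates that of \<open>\<psi>\<close> in the direction
      \<open>u\<close>.\<close>
    define L where "L t = ln (1 + sin t) - ln (1 - sin t)" for t :: real
    have tB: "of_real t * u \<in> B" "norm (of_real t * u) = t" "cos t > 0" "\<bar>sin t\<bar> < 1"
      if "t \<in> {0..norm z}" for t
    proof -
      show "norm (of_real t * u) = t"
        using u(1) that by (simp add: norm_mult)
      then show "of_real t * u \<in> B"
        using that z by (simp add: B_def)
      from cos_pos[OF this] show "cos t > 0"
        using \<open>norm (of_real t * u) = t\<close> by simp
      then have "(sin t)\<^sup>2 < 1"
        by (simp add: sin_squared_eq)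
      then show "\<bar>sin t\<bar> < 1"
        by (simp add: abs_square_less_1)
    qed
    have dL: "(L has_vector_derivative 2 / cos t) (at t)" if t: "t \<in> {0..norm z}" for t
    proof -
      have "1 + sin t > 0" "1 - sin t > 0"
        using tB(4)[OF t] by auto
      then have "(L has_field_derivative cos t / (1 + sin t) + cos t / (1 - sin t)) (at t)"
        unfolding L_def by (auto intro!: derivative_eq_intros)
      moreover have "cos t / (1 + sin t) + cos t / (1 - sin t) = 2 * cos t / (cos t)\<^sup>2"
      proof -
        have "(1 + sin t) * (1 - sin t) = (cos t)\<^sup>2"
          by (simp add: cos_squared_eq power2_eq_square algebra_simps)
        then show ?thesis
          using \<open>1 + sin t > 0\<close> \<open>1 - sin t > 0\<close>
          by (subst add_frac_eq) (simp_all add: algebra_simps)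
      qed
      ultimately show ?thesis
        using tB(3)[OF t]
        by (simp add: has_real_derivative_iff_has_vector_derivative power2_eq_square)
    qed
    have d\<psi>u: "((\<lambda>t. \<psi> (of_real t * u)) has_vector_derivative 2 / cos (of_real t * u) * u) (at t)"
      if t: "t \<in> {0..norm z}" for t
    proof -
      have "((\<lambda>t. of_real t * u) has_vector_derivative u) (at t)"
        by (auto intro!: derivative_eq_intros simp: has_vector_derivative_def scaleR_conv_of_real)
      from field_vector_diff_chain_at[OF this d\<psi>[OF tB(1)[OF t]]] show ?thesis
        by (simp add: o_def mult.commute)
    qed
    \<comment> \<open>Mean value inequality with a majorant: the derivatives compare because
      \<open>norm u = 1\<close> and \<open>cos t \<le> |cos (t u)|\<close>.\<close>
    have "norm (\<psi> (of_real (norm z) * u) - \<psi> (of_real 0 * u)) \<le> L (norm z) - L 0"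
    proof (rule differentiable_bound_general[where f' = "\<lambda>t. 2 / cos (of_real t * u) * u"
            and \<phi>' = "\<lambda>t. 2 / cos t"])
      show "continuous_on {0..norm z} (\<lambda>t. \<psi> (of_real t * u))" "continuous_on {0..norm z} L"
        using d\<psi>u dL by (blast intro: continuous_at_imp_continuous_on has_vector_derivative_continuous)+
    next
      fix t assume "0 < t" "t < norm z"
      then have t: "t \<in> {0..norm z}"
        by simp
      show "((\<lambda>t. \<psi> (of_real t * u)) has_vector_derivative 2 / cos (of_real t * u) * u) (at t)"
        "(L has_vector_derivative 2 / cos t) (at t)"
        using d\<psi>u[OF t] dL[OF t] .
      show "norm (2 / cos (of_real t * u) * u) \<le> 2 / cos t"
        using cos_le[OF tB(1)[OF t]] tB(2,3)[OF t] u(1)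
        by (auto simp: norm_mult norm_divide intro!: divide_left_mono mult_pos_pos)
    qed (use False in simp)
    moreover have "1 + sin (norm z) > 0" "1 - sin (norm z) > 0"
      using tB(4)[of "norm z"] by auto
    ultimately show ?thesis
      using u(2)[symmetric] \<open>\<psi> 0 = 0\<close> by (simp add: L_def ln_div)
  qed (simp add: \<open>\<psi> 0 = 0\<close>)
  ultimately show ?thesis
    using that by (simp add: B_def)
qed

text \<open>The equation \<open>z f' / f = p\<close> is solved by
  \<open>f z = z * exp (G z - G 0)\<close>, where \<open>G\<close> is a primitive of
  \<open>(p - 1) / z\<close>. This supplies the extremal function.\<close>

lemma exists_with_starlike_quotient:
  assumes "p holomorphic_on unit_disc" "p 0 = 1"
  obtains f where "f \<in> class_A" "\<And>z. z \<in> unit_disc - {0} \<Longrightarrow> f z \<noteq> 0"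
    "\<And>z. z \<in> unit_disc \<Longrightarrow> starlike_quotient f z = p z"
proof -
  \<comment> \<open>The singularity of \<open>(p z - 1) / z\<close> at 0 is removable because
    \<open>p 0 = 1\<close>; the value there is the limit.\<close>
  define q where "q z = (if z = 0 then deriv p 0 else (p z - p 0) / (z - 0))" for z
  have "q holomorphic_on unit_disc"
    unfolding q_def using assms(1) by (intro pole_lemma) auto
  then obtain G where G: "\<And>z. z \<in> unit_disc \<Longrightarrow> (G has_field_derivative q z) (at z within unit_disc)"
    using holomorphic_convex_primitive'[OF convex_ball open_ball] by blast
  define f where "f z = z * exp (G z - G 0)" for z
  have df: "(f has_field_derivative exp (G z - G 0) * p z) (at z)" if z: "z \<in> unit_disc" for z
  proof -
    have "(G has_field_derivative q z) (at z)"
      using G[OF z] z by (simp add: at_within_open[OF z open_ball])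
    then have "(f has_field_derivative exp (G z - G 0) * (1 + z * q z)) (at z)"
      unfolding f_def by (auto intro!: derivative_eq_intros simp: algebra_simps)
    moreover have "1 + z * q z = p z"
      using assms(2) by (simp add: q_def)
    ultimately show ?thesis
      by simp
  qed
  show thesis
  proof
    have "f holomorphic_on unit_disc"
      using df by (subst holomorphic_on_open) blast+
    then show "f \<in> class_A"
      using DERIV_imp_deriv[OF df[of 0]] assms(2) by (simp add: class_A_def f_def)
    show "f z \<noteq> 0" if "z \<in> unit_disc - {0}" for z
      using that by (simp add: f_def)
    show "starlike_quotient f z = p z" if "z \<in> unit_disc" for z
      using DERIV_imp_deriv[OF df[OF that]] assms(2) by (simp add: starlike_quotient_def f_def)
  qed
qed

lemma mult_of_real_in_unit_disc:
  assumes "0 < r" "r \<le> 1" "z \<in> unit_disc"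
  shows "of_real r * z \<in> unit_disc"
  using assms mult_right_mono[of r 1 "norm z"] by (auto simp: norm_mult)

text \<open>Dilation only rescales the argument of the quotient: the derivative at \<open>z\<close>
  is \<open>deriv f (r z)\<close>, and the factor \<open>1 / r\<close> in the function turns
  \<open>z\<close> into \<open>r z\<close>. At the origin both sides are 1.\<close>

lemma
  assumes "0 < r" "r \<le> 1" "f \<in> class_A"
  shows dilation_in_class_A: "(\<lambda>z. f (of_real r * z) / of_real r) \<in> class_A"
    and starlike_quotient_dilation: "z \<in> unit_disc \<Longrightarrow>
      starlike_quotient (\<lambda>z. f (of_real r * z) / of_real r) z = starlike_quotient f (of_real r * z)"
proof -
  have f: "f holomorphic_on unit_disc" "f 0 = 0" "deriv f 0 = 1"
    using assms(3) by (auto simp: class_A_def)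
  define F where "F z = f (of_real r * z) / of_real r" for z
  have dF: "(F has_field_derivative deriv f (of_real r * z)) (at z)" if "z \<in> unit_disc" for z
  proof -
    have "(f has_field_derivative deriv f (of_real r * z)) (at (of_real r * z))"
      using holomorphic_derivI[OF f(1) open_ball mult_of_real_in_unit_disc[OF assms(1,2) that]] .
    moreover have "((\<lambda>z. of_real r * z) has_field_derivative of_real r) (at z)"
      by (auto intro!: derivative_eq_intros)
    ultimately have "((\<lambda>z. f (of_real r * z)) has_field_derivative
                       deriv f (of_real r * z) * of_real r) (at z)"
      by (rule DERIV_chain2)
    then show ?thesis
      unfolding F_def using assms(1) DERIV_cdivide[of _ _ _ _ "of_real r"] by fastforce
  qed
  have "F holomorphic_on unit_disc"
    using dF by (subst holomorphic_on_open) blast+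
  then show "(\<lambda>z. f (of_real r * z) / of_real r) \<in> class_A"
    using DERIV_imp_deriv[OF dF[of 0]] f by (simp add: class_A_def F_def[abs_def])
  show "starlike_quotient (\<lambda>z. f (of_real r * z) / of_real r) z = starlike_quotient f (of_real r * z)"
    if "z \<in> unit_disc"
    using DERIV_imp_deriv[OF dF[OF that]] assms(1)
    by (simp add: starlike_quotient_def F_def[abs_def])
qed

text \<open>Taking moduli fixes the real part, which handles all the preimages
  \<open>1 + 2 pi i k\<close> at once.\<close>

lemma norm_ge_1_if_exp_eq_exp_1:
  fixes w :: complex
  assumes "exp w = exp 1"
  shows "norm w \<ge> 1"
proof -
  have "Re w = 1"
    using arg_cong[OF assms, of norm] by simp
  then show ?thesis
    using complex_Re_le_cmod[of w] by simp
qed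

theorem theorem7p1:
  shows "starlike_radius phi_SG phi_S = arcsin ((exp 1 - 1) / (exp 1 + 1))"
proof -
  \<comment> \<open>This is \<open>tanh (1/2)\<close>, so that
    \<open>phi_SG 1 = 1 + s\<close>.\<close>
  define s :: real where "s = (exp 1 - 1) / (exp 1 + 1)"
  define \<rho> where "\<rho> = arcsin s"
  \<comment> \<open>The upper bound amounts to \<open>e \<le> 3\<close>; it yields
    \<open>\<rho> \<le> pi/6 < 1\<close>, so \<open>\<rho>\<close> is an admissible radius.\<close>
  have s: "0 < s" "s \<le> 1/2"
    using exp_le by (simp_all add: s_def divide_le_eq add_pos_pos)
  have exp_s: "(1 + s) / (1 - s) = exp 1"
  proof -
    have pos: "exp 1 + 1 > (0::real)"
      by (intro add_pos_pos) auto
    then have "1 + s = 2 * exp 1 / (exp 1 + 1)" "1 - s = 2 / (exp 1 + 1)"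
      unfolding s_def using pos by (simp_all add: add_divide_eq_iff diff_divide_eq_iff)
    then show ?thesis
      using pos by (simp only: divide_divide_eq_right) simp
  qed
  have sin_\<rho>: "sin \<rho> = s"
    using s by (simp add: \<rho>_def)
  have "\<rho> \<le> arcsin (1/2)"
    unfolding \<rho>_def using s by (intro arcsin_le_arcsin) auto
  also have "arcsin (1/2) = pi/6"
    by simp
  finally have \<rho>: "0 < \<rho>" "\<rho> < 1" "\<rho> < pi/2"
    using s pi_less_4 pi_gt_zero arcsin_less_arcsin[of 0 s] by (auto simp: \<rho>_def)

  obtain \<psi> :: "complex \<Rightarrow> complex" where \<psi>: "\<psi> holomorphic_on ball 0 (pi/2)" "\<psi> 0 = 0"
    "\<And>z. norm z < pi/2 \<Longrightarrow> (1 - sin z) * exp (\<psi> z) = 1 + sin z"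
    "\<And>z. norm z < pi/2 \<Longrightarrow> norm (\<psi> z) \<le> ln ((1 + sin (norm z)) / (1 - sin (norm z)))"
    using artanh_sin_majorised by blast
  \<comment> \<open>The majorant is strictly increasing and equals \<open>ln (exp 1) = 1\<close> at
    \<open>\<rho>\<close>.\<close>
  have norm_\<psi>: "norm (\<psi> z) < 1" if "norm z < \<rho>" for z
  proof -
    have "sin (norm z) < s"
      unfolding sin_\<rho>[symmetric] using that \<rho>
      by (intro sin_monotone_2pi) (auto intro: order_trans[of _ 0])
    moreover have "0 \<le> sin (norm z)"
      using that \<rho> by (intro sin_ge_zero) (simp, linarith)
    ultimately have "(1 + sin (norm z)) / (1 - sin (norm z)) < exp 1"
      unfolding exp_s[symmetric] using s by (intro frac_less) auto
    then have "ln ((1 + sin (norm z)) / (1 - sin (norm z))) < ln (exp 1)"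
      using \<open>0 \<le> sin (norm z)\<close> \<open>sin (norm z) < s\<close> s by (subst ln_less_cancel_iff) auto
    then show ?thesis
      using \<psi>(4)[of z] that \<rho> by simp
  qed
  have phi_\<psi>: "phi_SG (\<psi> z) = phi_S z" if "norm z < pi/2" for z
  proof -
    have "(1 + sin z) * exp (- \<psi> z) = 1 - sin z"
      using \<psi>(3)[OF that] by (simp add: exp_minus field_simps)
    \<comment> \<open>A product equal to 2 also shows that the denominator of \<open>phi_SG\<close>
      does not vanish.\<close>
    then have "(1 + sin z) * (1 + exp (- \<psi> z)) = 2"
      by (simp add: algebra_simps)
    then show ?thesis
      by (metis phi_SG_def phi_S_def mult_eq_0_iff nonzero_eq_divide_eq zero_neq_numeral)
  qed

  \<comment> \<open>The radius \<rho> is attained: \<open>\<psi>\<close> applied to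
    \<open>\<omega> (\<rho> z)\<close> is the new Schwarz function.\<close>
  have "(\<lambda>z. f (of_real \<rho> * z) / of_real \<rho>) \<in> starlike_class phi_SG"
    if f: "f \<in> starlike_class phi_S" for f
  proof -
    have fA: "f \<in> class_A" and f_nz: "\<And>z. z \<in> unit_disc - {0} \<Longrightarrow> f z \<noteq> 0"
      using f by (auto simp: starlike_class_def)
    from f obtain \<omega> where \<omega>: "\<omega> holomorphic_on unit_disc" "\<omega> ` unit_disc \<subseteq> unit_disc" "\<omega> 0 = 0"
      "\<And>z. z \<in> unit_disc \<Longrightarrow> starlike_quotient f z = phi_S (\<omega> z)"
      by (auto simp: starlike_class_def subordinate_def)
    note in_disc = mult_of_real_in_unit_disc[OF \<rho>(1) less_imp_le[OF \<rho>(2)]]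
    have norm_\<omega>: "norm (\<omega> (of_real \<rho> * z)) < \<rho>" if "z \<in> unit_disc" for z
    proof -
      have "norm (\<omega> (of_real \<rho> * z)) \<le> norm (of_real \<rho> * z)"
        using in_disc[OF that] \<omega>(2) by (intro Schwarz_Lemma(1)[OF \<omega>(1,3)]) force+
      also have "\<dots> < \<rho>"
        using that \<rho>(1) by (simp add: norm_mult)
      finally show ?thesis .
    qed
    define \<eta> where "\<eta> z = \<psi> (\<omega> (of_real \<rho> * z))" for z
    have "(\<lambda>z. \<omega> (of_real \<rho> * z)) holomorphic_on unit_disc"
      using in_disc
      by (intro holomorphic_on_compose_gen[OF _ \<omega>(1), unfolded o_def] holomorphic_intros) auto
    then have "\<eta> holomorphic_on unit_disc"
      unfolding \<eta>_def using norm_\<omega> \<rho>(3)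
      by (intro holomorphic_on_compose_gen[OF _ \<psi>(1), unfolded o_def]) force+
    moreover have "\<eta> ` unit_disc \<subseteq> unit_disc"
      using norm_\<psi> norm_\<omega> by (auto simp: \<eta>_def)
    moreover have "\<eta> 0 = 0"
      by (simp add: \<eta>_def \<omega>(3) \<psi>(2))
    moreover have "starlike_quotient (\<lambda>z. f (of_real \<rho> * z) / of_real \<rho>) z = phi_SG (\<eta> z)"
      if "z \<in> unit_disc" for z
      using starlike_quotient_dilation[OF \<rho>(1) less_imp_le[OF \<rho>(2)] fA that]
        \<omega>(4)[OF in_disc[OF that]] phi_\<psi>[of "\<omega> (of_real \<rho> * z)"] norm_\<omega>[OF that] \<rho>(3)
      by (simp add: \<eta>_def)
    ultimately have "subordinate (starlike_quotient (\<lambda>z. f (of_real \<rho> * z) / of_real \<rho>)) phi_SG"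
      unfolding subordinate_def by blast
    moreover have "f (of_real \<rho> * z) / of_real \<rho> \<noteq> 0" if "z \<in> unit_disc - {0}" for z
      using f_nz[of "of_real \<rho> * z"] in_disc[of z] that \<rho>(1) by auto
    ultimately show ?thesis
      using dilation_in_class_A[OF \<rho>(1) less_imp_le[OF \<rho>(2)] fA]
      by (simp add: starlike_class_def)
  qed
  moreover have "r \<le> \<rho>"
    if r: "0 < r" "r \<le> 1"
      and dil: "\<And>f. f \<in> starlike_class phi_S \<Longrightarrow>
             (\<lambda>z. f (of_real r * z) / of_real r) \<in> starlike_class phi_SG" for r
  proof (rule ccontr)
    assume "\<not> r \<le> \<rho>"
    \<comment> \<open>The extremal function, whose Schwarz function is the identity.\<close>
    obtain f where f: "f \<in> class_A" "\<And>z. z \<in> unit_disc - {0} \<Longrightarrow> f z \<noteq> 0"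
      "\<And>z. z \<in> unit_disc \<Longrightarrow> starlike_quotient f z = phi_S z"
    proof (rule exists_with_starlike_quotient[of phi_S])
      show "phi_S holomorphic_on unit_disc"
        unfolding phi_S_def by (intro holomorphic_intros)
    qed (auto simp: phi_S_def)
    have "subordinate (starlike_quotient f) phi_S"
      unfolding subordinate_def using f(3) by (intro exI[of _ "\<lambda>z. z"]) auto
    then have "f \<in> starlike_class phi_S"
      using f(1,2) by (simp add: starlike_class_def)
    from dil[OF this] obtain \<omega> where \<omega>: "\<omega> ` unit_disc \<subseteq> unit_disc"
      "\<And>z. z \<in> unit_disc \<Longrightarrow>
        starlike_quotient (\<lambda>z. f (of_real r * z) / of_real r) z = phi_SG (\<omega> z)"
      by (auto simp: starlike_class_def subordinate_def)
    \<comment> \<open>The point that dilation by \<open>r\<close> sends to \<rho>; it lies in the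
      disc exactly because \<open>\<rho> < r\<close>.\<close>
    define x :: complex where "x = of_real (\<rho> / r)"
    have x: "x \<in> unit_disc" "of_real r * x = of_real \<rho>"
      using \<open>\<not> r \<le> \<rho>\<close> r(1) \<rho>(1) by (auto simp: x_def norm_divide)
    have "phi_SG (\<omega> x) = phi_S (of_real \<rho>)"
      using \<omega>(2)[OF x(1)] starlike_quotient_dilation[OF r f(1) x(1)]
        f(3)[OF mult_of_real_in_unit_disc[OF r x(1)]] x(2) by simp
    also have "\<dots> = 1 + of_real s"
      by (simp add: phi_S_def sin_of_real sin_\<rho>)
    finally have eq: "2 / (1 + exp (- \<omega> x)) = 1 + of_real s"
      by (simp add: phi_SG_def)
    have nz: "1 + complex_of_real s \<noteq> 0" "1 - complex_of_real s \<noteq> 0"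
      using s by (simp_all add: complex_eq_iff)
    \<comment> \<open>Were it zero, the quotient in \<open>eq\<close> would be 0 by the convention
      for division, but \<open>1 + s\<close> is nonzero.\<close>
    have "1 + exp (- \<omega> x) \<noteq> 0"
      using eq nz by auto
    then have "(1 + of_real s) * exp (- \<omega> x) = 1 - of_real s"
      using eq by (simp add: field_simps)
    then have "exp (\<omega> x) = (1 + of_real s) / (1 - of_real s)"
      using nz by (simp add: exp_minus field_simps)
    also have "\<dots> = of_real ((1 + s) / (1 - s))"
      by simp
    also have "\<dots> = exp 1"
      unfolding exp_s by (simp add: exp_of_real[symmetric])
    finally have "norm (\<omega> x) \<ge> 1"
      by (rule norm_ge_1_if_exp_eq_exp_1)
    then show False
      using \<omega>(1) x(1) by force
  qed
  ultimately have "starlike_radius phi_SG phi_S = \<rho>"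
    unfolding starlike_radius_def using \<rho> by (intro cSup_eq_maximum) auto
  then show ?thesis
    by (simp add: \<rho>_def s_def)
qed

end
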